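(* Let an Adinkra with $N$ colors and vertex set $V$ be given, with $4\mid \#V$ (automatic if $N\ge 2$), let $X$ be its boson–fermion matrix and $L$ its signed Laplacian. If $$(x_1,\ldots,x_{\#V/4},\,N/x_{\#V/4},\ldots,N/x_1)$$ are the invariant factors of $X$, then the invariant factors of $L$ are $$\left(x_1,x_1,x_2,x_2,\ldots,x_{\#V/4},x_{\#V/4},\ \tfrac{N(N-1)}{x_{\#V/4}},\tfrac{N(N-1)}{x_{\#V/4}},\ \ldots,\ \tfrac{N(N-1)}{x_1},\tfrac{N(N-1)}{x_1}\right).$$ That is, one multiplies each of the largest $\#V/4$ invariant factors of $X$ by $N-1$ and then doubles the multiplicity of all invariant factors.
   Context: A signed graph is a finite undirected simple graph $(V,E)$ with a signature $\mu:E\to\{-1,1\}$; edges with $\mu(e)=-1$ are called dashed, those with $\mu(e)=1$ solid. An Adinkra with $N\ge 1$ colors is a non-empty finite bipartite signed graph $(V,E,\mu)$ (with a fixed bipartition of $V$ into bosons and fermions, every edge joining a boson to a fermion), together with an assignment of one of $N$ colors to each edge and a function $h:V\to\mathbb{Z}$ (the function $h$ plays no role here), such that: (i) each vertex is incident to exactly $N$ edges, one of each color; (ii) for any two distinct colors, the subgraph consisting of all edges of those two colors is a disjoint union of $4$-cycles (called bicolor cycles); (iii) every bicolor cycle contains an odd number of dashed edges; (iv) $|h(v)-h(w)|=1$ for adjacent $v,w$. An Adinkra need not be connected; there are $\#V/2$ bosons and $\#V/2$ fermions. $X$ is the $\frac{\#V}{2}\times\frac{\#V}{2}$ integer matrix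 whose $(i,j)$ entry is $\mu(e)$ if there is an edge $e$ between the $i$th boson and $j$th fermion, and $0$ otherwise. With bosons ordered first, the signed adjacency matrix is $A=\begin{pmatrix} 0 & X \\ X^T & 0 \end{pmatrix}$ and the signed Laplacian is $L=NI-A=\begin{pmatrix} NI & -X \\ -X^T & NI \end{pmatrix}$. The invariant factors of an integer square matrix are the nonnegative diagonal entries $d_1\mid d_2\mid\cdots$ of its Smith Normal Form over $\mathbb{Z}$, listed in this order with multiplicity (entries may be $0$). *)

theory Defs
  imports "Jordan_Normal_Form.Matrix"
begin

(* Edges are two-element sets of vertices; \<mu> is only constrained on edges. *)
locale signed_graph =
  fixes V :: "'a set" and E :: "'a set set" and \<mu> :: "'a set \<Rightarrow> int"
  assumes finite_vertices: "finite V"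
    and edge: "\<And>e. e \<in> E \<Longrightarrow> e \<subseteq> V \<and> card e = 2"
    and signature: "\<And>e. e \<in> E \<Longrightarrow> \<mu> e \<in> {-1, 1}"

definition four_cycle :: "'a set set \<Rightarrow> bool" where
  "four_cycle C \<longleftrightarrow>
     (\<exists>a b c d. distinct [a, b, c, d] \<and> C = {{a, b}, {b, c}, {c, d}, {d, a}})"

definition disjoint_union_of_four_cycles :: "'a set set \<Rightarrow> bool" where
  "disjoint_union_of_four_cycles D \<longleftrightarrow>
     (\<exists>\<C>. (\<forall>C\<in>\<C>. four_cycle C) \<and>
          (\<forall>C\<in>\<C>. \<forall>C'\<in>\<C>. C \<noteq> C' \<longrightarrow> \<Union>C \<inter> \<Union>C' = {}) \<and>
          D = \<Union>\<C>)"

definition bicolor_edges :: "'a set set \<Rightarrow> ('a set \<Rightarrow> nat) \<Rightarrow> nat \<Rightarrow> nat \<Rightarrow> 'a set set" where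
  "bicolor_edges E color c d = {e \<in> E. color e = c \<or> color e = d}"

(* In a vertex-disjoint union of 4-cycles, the 4-cycles contained in it are exactly its
   components, so this describes the components of the two-color subgraphs. *)
definition bicolor_cycle :: "'a set set \<Rightarrow> nat \<Rightarrow> ('a set \<Rightarrow> nat) \<Rightarrow> 'a set set \<Rightarrow> bool" where
  "bicolor_cycle E N color C \<longleftrightarrow>
     four_cycle C \<and> (\<exists>c<N. \<exists>d<N. c \<noteq> d \<and> C \<subseteq> bicolor_edges E color c d)"

(* B are the bosons, F the fermions; the N colors are 0, ..., N - 1. Since every edge has one of
   these colors, one_edge_per_color also gives that each vertex has degree N. *)
locale adinkra = signed_graph V E \<mu>
  for V :: "'a set" and E :: "'a set set" and \<mu> :: "'a set \<Rightarrow> int" +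
  fixes N :: nat and B F :: "'a set" and color :: "'a set \<Rightarrow> nat" and h :: "'a \<Rightarrow> int"
  assumes N_pos: "N \<ge> 1"
    and nonempty: "V \<noteq> {}"
    and bipartition: "B \<union> F = V" "B \<inter> F = {}"
    and bipartite: "\<And>e. e \<in> E \<Longrightarrow> \<exists>b\<in>B. \<exists>f\<in>F. e = {b, f}"
    and color_range: "\<And>e. e \<in> E \<Longrightarrow> color e < N"
    and one_edge_per_color: "\<And>v c. v \<in> V \<Longrightarrow> c < N \<Longrightarrow> \<exists>!e. e \<in> E \<and> v \<in> e \<and> color e = c"
    and bicolor: "\<And>c d. c < N \<Longrightarrow> d < N \<Longrightarrow> c \<noteq> d \<Longrightarrow>
                    disjoint_union_of_four_cycles (bicolor_edges E color c d)"
    and odd_dashed: "\<And>C. bicolor_cycle E N color C \<Longrightarrow> odd (card {e \<in> C. \<mu> e = -1})"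
    and height: "\<And>v w. {v, w} \<in> E \<Longrightarrow> \<bar>h v - h w\<bar> = 1"

(* The lists bs and fs are the chosen orderings of the bosons and of the fermions. *)
definition boson_fermion_mat ::
    "'a set set \<Rightarrow> ('a set \<Rightarrow> int) \<Rightarrow> 'a list \<Rightarrow> 'a list \<Rightarrow> int mat" where
  "boson_fermion_mat E \<mu> bs fs =
     mat (length bs) (length fs) (\<lambda>(i, j). if {bs ! i, fs ! j} \<in> E then \<mu> {bs ! i, fs ! j} else 0)"

definition signed_adjacency_mat :: "int mat \<Rightarrow> int mat" where
  "signed_adjacency_mat X =
     four_block_mat (0\<^sub>m (dim_row X) (dim_row X)) X
                    (transpose_mat X) (0\<^sub>m (dim_col X) (dim_col X))"

definition signed_laplacian_mat :: "nat \<Rightarrow> int mat \<Rightarrow> int mat" where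
  "signed_laplacian_mat N X =
     int N \<cdot>\<^sub>m 1\<^sub>m (dim_row X + dim_col X) - signed_adjacency_mat X"

definition smith_normal_form :: "int mat \<Rightarrow> bool" where
  "smith_normal_form S \<longleftrightarrow> square_mat S \<and> diagonal_mat S \<and>
     (\<forall>i<dim_row S. S $$ (i, i) \<ge> 0) \<and>
     (\<forall>i. Suc i < dim_row S \<longrightarrow> S $$ (i, i) dvd S $$ (Suc i, Suc i))"

(* The Smith normal form of an integer matrix is unique, so ds is determined by M.
   For integer matrices, invertible_mat means invertible over the integers. *)
definition invariant_factors :: "int mat \<Rightarrow> int list \<Rightarrow> bool" where
  "invariant_factors M ds \<longleftrightarrow>
     (\<exists>n P Q. M \<in> carrier_mat n n \<and> P \<in> carrier_mat n n \<and> Q \<in> carrier_mat n n \<and>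
        invertible_mat P \<and> invertible_mat Q \<and>
        smith_normal_form (P * M * Q) \<and> ds = diag_mat (P * M * Q))"

end

theory Submission
  imports Defs
begin

text \<open>
  The combinatorics of an Adinkra amounts to the identity \<open>X X\<^sup>T = N I\<close>. Each boson has \<open>N\<close>
  neighbours, which gives the diagonal. A common neighbour of two distinct bosons lies with them
  on a bicolor cycle, whose fourth vertex is another common neighbour. Since the cycle has an odd
  number of dashed edges, these two neighbours contribute opposite terms to the scalar product of
  the two rows, which is therefore \<open>0\<close>.

  Let \<open>P X Q = D\<close> be the Smith normal form of \<open>X\<close>, with diagonal entries \<open>d\<^sub>k\<close>. Then
  \<open>D (Q\<^sup>-\<^sup>1 X\<^sup>T P\<^sup>-\<^sup>1) = P (X X\<^sup>T) P\<^sup>-\<^sup>1 = N I\<close>, so the inverse base changes bring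
  \<open>X\<^sup>T\<close> to the diagonal matrix with entries \<open>N / d\<^sub>k\<close>
  (\<open>signed_laplacian_unimodular_equivalent\<close>). Hence the Laplacian is equivalent over the integers
  to a direct sum of the \<open>2 \<times> 2\<close> matrices with rows \<open>(N, - d\<^sub>k)\<close> and \<open>(- N / d\<^sub>k, N)\<close>. Each of
  them has determinant \<open>N (N - 1)\<close>, and integer row and column operations turn it into a diagonal
  matrix with entries \<open>x\<close> and \<open>(N - 1) y\<close>, where \<open>{x, y} = {d\<^sub>k, N / d\<^sub>k}\<close>
  (\<open>diag_blocks_laplacian_reduction\<close>).

  Because the invariant factors \<open>d\<^sub>k\<close> and \<open>N / d\<^sub>k\<close> of \<open>X\<close> sit at mirror positions, taking
  for \<open>x\<close> the one from the first half of the list makes every number \<open>f\<^sub>j\<close> occur twice, where \<open>f\<^sub>j\<close> is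
  \<open>d\<^sub>j\<close> in the first half and \<open>(N - 1) d\<^sub>j\<close> in the second half. A permutation
  (\<open>interleave_diagonal\<close>) puts equal entries next to each other, and the divisibility chain is
  inherited from the one of the \<open>d\<^sub>j\<close>.
\<close>

section \<open>Orthogonality of the boson-fermion matrix\<close>

lemma prod_signs_eq_power_card:
  fixes \<mu> :: "'b \<Rightarrow> int"
  assumes "finite C" "\<And>e. e \<in> C \<Longrightarrow> \<mu> e \<in> {-1, 1}"
  shows "(\<Prod>e\<in>C. \<mu> e) = (-1) ^ card {e \<in> C. \<mu> e = -1}"
proof -
  have "(\<Prod>e\<in>C. \<mu> e) = (\<Prod>e\<in>C. if \<mu> e = -1 then -1 else 1)"
    using assms(2) by (intro prod.cong) auto
  also have "\<dots> = (\<Prod>e\<in>{e \<in> C. \<mu> e = -1}. -1)"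
    using assms(1) by (rule prod.inter_filter[symmetric])
  finally show ?thesis by simp
qed

text \<open>
  In a 4-cycle the two neighbours of a vertex \<open>f\<close> are opposite, so a fourth vertex \<open>g\<close>,
  opposite to \<open>f\<close>, is adjacent to both. Which corner \<open>f\<close> is and which of its neighbours is
  \<open>u\<close> gives eight cases.
\<close>

lemma four_cycle_common_vertex:
  assumes "four_cycle C" "{u, f} \<in> C" "{v, f} \<in> C" "u \<noteq> v"
  obtains g where "distinct [u, f, v, g]" "C = {{u, f}, {v, f}, {u, g}, {v, g}}"
proof -
  obtain a b c d where abcd: "distinct [a, b, c, d]" and C: "C = {{a, b}, {b, c}, {c, d}, {d, a}}"
    using assms(1) unfolding four_cycle_def by blast
  have "f = a \<and> {u, v} = {b, d} \<or> f = b \<and> {u, v} = {a, c} \<or>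
      f = c \<and> {u, v} = {b, d} \<or> f = d \<and> {u, v} = {a, c}"
    using assms(2-4) abcd unfolding C by (simp add: doubleton_eq_iff) metis
  then consider "f = a" "u = b" "v = d" | "f = a" "u = d" "v = b"
    | "f = b" "u = a" "v = c" | "f = b" "u = c" "v = a"
    | "f = c" "u = b" "v = d" | "f = c" "u = d" "v = b"
    | "f = d" "u = a" "v = c" | "f = d" "u = c" "v = a"
    by (auto simp: doubleton_eq_iff)
  then show ?thesis
  proof cases
    case 1 show ?thesis by (rule that[of c]) (use abcd 1 C in \<open>auto simp: insert_commute\<close>)
  next
    case 2 show ?thesis by (rule that[of c]) (use abcd 2 C in \<open>auto simp: insert_commute\<close>)
  next
    case 3 show ?thesis by (rule that[of d]) (use abcd 3 C in \<open>auto simp: insert_commute\<close>)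
  next
    case 4 show ?thesis by (rule that[of d]) (use abcd 4 C in \<open>auto simp: insert_commute\<close>)
  next
    case 5 show ?thesis by (rule that[of a]) (use abcd 5 C in \<open>auto simp: insert_commute\<close>)
  next
    case 6 show ?thesis by (rule that[of a]) (use abcd 6 C in \<open>auto simp: insert_commute\<close>)
  next
    case 7 show ?thesis by (rule that[of b]) (use abcd 7 C in \<open>auto simp: insert_commute\<close>)
  next
    case 8 show ?thesis by (rule that[of b]) (use abcd 8 C in \<open>auto simp: insert_commute\<close>)
  qed
qed

context adinkra begin

definition weight :: "'a \<Rightarrow> 'a \<Rightarrow> int" where
  "weight b f = (if {b, f} \<in> E then \<mu> {b, f} else 0)"

lemma edge_color_inj:
  assumes "{v, f} \<in> E" "{v, g} \<in> E" "color {v, f} = color {v, g}"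
  shows "f = g"
proof -
  have "v \<in> V" using edge[OF assms(1)] by simp
  from one_edge_per_color[OF this color_range[OF assms(1)]] assms
  have "{v, f} = {v, g}" by (metis insertI1)
  then show ?thesis by (auto simp: doubleton_eq_iff)
qed

lemma fermion_of_edge:
  assumes "{b, f} \<in> E" "b \<in> B"
  shows "f \<in> F"
  using bipartite[OF assms(1)] bipartition(2) assms(2) by (auto simp: doubleton_eq_iff)

lemma finite_fermions: "finite F"
  using bipartition(1) finite_vertices by auto

lemma sum_weight_square:
  assumes b: "b \<in> B"
  shows "(\<Sum>f\<in>F. weight b f * weight b f) = int N"
proof -
  have V: "b \<in> V" using b bipartition(1) by auto
  have "bij_betw (\<lambda>f. color {b, f}) {f \<in> F. {b, f} \<in> E} {..<N}"
  proof (rule bij_betw_imageI)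
    show "inj_on (\<lambda>f. color {b, f}) {f \<in> F. {b, f} \<in> E}"
      using edge_color_inj by (intro inj_onI) auto
    show "(\<lambda>f. color {b, f}) ` {f \<in> F. {b, f} \<in> E} = {..<N}"
    proof (intro equalityI subsetI)
      fix c assume "c \<in> {..<N}"
      then obtain e where e: "e \<in> E" "b \<in> e" "color e = c"
        using one_edge_per_color[OF V, of c] by auto
      obtain f where "e = {b, f}"
        using bipartite[OF e(1)] e(2) by (auto simp: insert_commute)
      then show "c \<in> (\<lambda>f. color {b, f}) ` {f \<in> F. {b, f} \<in> E}"
        using e fermion_of_edge[OF _ b] by auto
    qed (use color_range in auto)
  qed
  then have card: "card {f \<in> F. {b, f} \<in> E} = N"
    using bij_betw_same_card by fastforce
  have "\<mu> e * \<mu> e = 1" if "e \<in> E" for e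
    using signature[OF that] by auto
  then have "(\<Sum>f\<in>F. weight b f * weight b f) = (\<Sum>f\<in>F. if {b, f} \<in> E then 1 else 0)"
    by (intro sum.cong) (auto simp: weight_def)
  also have "\<dots> = int (card {f \<in> F. {b, f} \<in> E})"
    by (simp add: finite_fermions sum.inter_filter[symmetric])
  finally show ?thesis using card by simp
qed

text \<open>
  The two edges from \<open>f\<close> to \<open>u\<close> and \<open>v\<close> have different colors and meet in \<open>f\<close>, so they lie on
  one bicolor cycle; \<open>g\<close> is its fourth vertex. Colors alternate along the cycle, which makes
  \<open>g\<close> determined by \<open>f\<close> and conversely, and the product of the four signs is \<open>-1\<close>.
\<close>

lemma opposite_common_neighbour:
  assumes "u \<in> B" "u \<noteq> v" "{u, f} \<in> E" "{v, f} \<in> E"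
  shows "\<exists>g. g \<in> F \<and> {u, g} \<in> E \<and> {v, g} \<in> E \<and>
    color {u, g} = color {v, f} \<and> color {v, g} = color {u, f} \<and>
    weight u g * weight v g = - (weight u f * weight v f)"
proof -
  define c where "c = color {u, f}"
  define d where "d = color {v, f}"
  have cd: "c < N" "d < N" unfolding c_def d_def using color_range assms(3,4) by auto
  have "c \<noteq> d"
    using edge_color_inj[of f u v] assms(2-4) unfolding c_def d_def by (auto simp: insert_commute)
  from bicolor[OF cd this] obtain \<C> where *: "(\<forall>C\<in>\<C>. four_cycle C) \<and>
      (\<forall>C\<in>\<C>. \<forall>C'\<in>\<C>. C \<noteq> C' \<longrightarrow> \<Union>C \<inter> \<Union>C' = {}) \<and>
      bicolor_edges E color c d = \<Union>\<C>"
    unfolding disjoint_union_of_four_cycles_def by (rule exE)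
  have \<C>: "four_cycle C" if "C \<in> \<C>" for C
    using * that by simp
  have disj: "\<Union>C \<inter> \<Union>C' = {}" if "C \<in> \<C>" "C' \<in> \<C>" "C \<noteq> C'" for C C'
    using conjunct1[OF conjunct2[OF *]] that by simp
  have un: "bicolor_edges E color c d = \<Union>\<C>"
    using * by simp
  have "{u, f} \<in> \<Union>\<C>" "{v, f} \<in> \<Union>\<C>"
    unfolding un[symmetric] bicolor_edges_def using assms(3,4) by (simp_all add: c_def d_def)
  then obtain C C' where C: "{u, f} \<in> C" "C \<in> \<C>" and C': "{v, f} \<in> C'" "C' \<in> \<C>"
    by (elim UnionE)
  have "f \<in> \<Union>C \<inter> \<Union>C'" using C C' by auto
  then have "C' = C" using disj[OF C(2) C'(2)] by blast
  with C' have "{v, f} \<in> C" by simp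
  from four_cycle_common_vertex[OF \<C>[OF C(2)] C(1) this assms(2)]
  obtain g where g: "distinct [u, f, v, g]" and Ceq: "C = {{u, f}, {v, f}, {u, g}, {v, g}}" .
  have sub: "C \<subseteq> bicolor_edges E color c d" using C(2) un by blast
  then have CE: "C \<subseteq> E" unfolding bicolor_edges_def by auto
  have E: "{u, g} \<in> E" "{v, g} \<in> E" using CE Ceq by auto
  have "color {u, g} = c \<or> color {u, g} = d" "color {v, g} = c \<or> color {v, g} = d"
    using sub Ceq unfolding bicolor_edges_def by auto
  moreover have "color {u, g} \<noteq> c" "color {v, g} \<noteq> d"
    using edge_color_inj[OF assms(3) E(1)] edge_color_inj[OF assms(4) E(2)] g
    unfolding c_def d_def by auto
  ultimately have col: "color {u, g} = d" "color {v, g} = c" by auto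
  have "bicolor_cycle E N color C"
    unfolding bicolor_cycle_def using \<C>[OF C(2)] cd \<open>c \<noteq> d\<close> sub by blast
  from odd_dashed[OF this] have odd: "odd (card {e \<in> C. \<mu> e = -1})" .
  have "finite C" unfolding Ceq by simp
  moreover have "\<mu> e \<in> {-1, 1}" if "e \<in> C" for e
    using that CE by (intro signature) auto
  ultimately have "(\<Prod>e\<in>C. \<mu> e) = (-1) ^ card {e \<in> C. \<mu> e = -1}"
    by (rule prod_signs_eq_power_card)
  also have "\<dots> = -1" using odd by simp
  finally have "(\<Prod>e\<in>C. \<mu> e) = -1" .
  moreover have "(\<Prod>e\<in>C. \<mu> e) = \<mu> {u, f} * \<mu> {v, f} * \<mu> {u, g} * \<mu> {v, g}"
    unfolding Ceq using g by (simp add: doubleton_eq_iff)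
  ultimately have prod: "\<mu> {u, f} * \<mu> {v, f} * \<mu> {u, g} * \<mu> {v, g} = -1" by simp
  have signs: "\<mu> {u, g} \<in> {-1, 1}" "\<mu> {v, g} \<in> {-1, 1}"
    using signature E by auto
  have "weight u g * weight v g = - (weight u f * weight v f)"
    unfolding weight_def using prod signs E assms(3,4) by (auto)
  then show ?thesis
    using fermion_of_edge[OF E(1) assms(1)] E col unfolding c_def d_def
    by (intro exI[of _ g] conjI)
qed

text \<open>
  Passing to the opposite common neighbour reverses the sign of the term and swaps the colors of
  the two edges. Doing it twice restores the colors, and a vertex has only one edge of each color,
  so it is an involution on the common neighbours.
\<close>

lemma sum_weight_orthogonal:
  assumes "u \<in> B" "u \<noteq> v"
  shows "(\<Sum>f\<in>F. weight u f * weight v f) = 0"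
proof -
  define S where "S = {f \<in> F. {u, f} \<in> E \<and> {v, f} \<in> E}"
  define w where "w f = weight u f * weight v f" for f
  have "\<exists>g. g \<in> S \<and> color {u, g} = color {v, f} \<and> color {v, g} = color {u, f} \<and> w g = - w f"
    if "f \<in> S" for f
    using opposite_common_neighbour[OF assms, of f] that unfolding S_def w_def by simp
  then obtain \<sigma> where \<sigma>: "\<And>f. f \<in> S \<Longrightarrow> \<sigma> f \<in> S" "\<And>f. f \<in> S \<Longrightarrow> color {u, \<sigma> f} = color {v, f}"
    "\<And>f. f \<in> S \<Longrightarrow> color {v, \<sigma> f} = color {u, f}" "\<And>f. f \<in> S \<Longrightarrow> w (\<sigma> f) = - w f"
    by metis
  have inv: "\<sigma> (\<sigma> f) = f" if "f \<in> S" for f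
    using edge_color_inj[of u "\<sigma> (\<sigma> f)" f] \<sigma> that unfolding S_def by auto
  have "sum w S = (\<Sum>f\<in>S. - w f)"
    by (rule sum.reindex_bij_witness[of S \<sigma> \<sigma>]) (auto simp: inv \<sigma>)
  then have "sum w S = 0" by (simp add: sum_negf)
  moreover have "sum w F = sum w S"
    by (rule sum.mono_neutral_right) (auto simp: finite_fermions S_def w_def weight_def)
  ultimately show ?thesis unfolding w_def by simp
qed

lemma boson_fermion_mat_mult_transpose:
  assumes "set bs = B" "distinct bs" "set fs = F" "distinct fs"
  shows "boson_fermion_mat E \<mu> bs fs * (boson_fermion_mat E \<mu> bs fs)\<^sup>T = int N \<cdot>\<^sub>m 1\<^sub>m (length bs)"
    (is "?X * ?X\<^sup>T = _")
proof (intro eq_matI)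
  fix i j assume "i < dim_row (int N \<cdot>\<^sub>m 1\<^sub>m (length bs))" "j < dim_col (int N \<cdot>\<^sub>m 1\<^sub>m (length bs))"
  then have ij: "i < length bs" "j < length bs" by auto
  have "(?X * ?X\<^sup>T) $$ (i, j) = (\<Sum>k<length fs. weight (bs ! i) (fs ! k) * weight (bs ! j) (fs ! k))"
    using ij by (simp add: boson_fermion_mat_def weight_def scalar_prod_def lessThan_atLeast0)
  also have "\<dots> = (\<Sum>f\<in>F. weight (bs ! i) f * weight (bs ! j) f)"
    unfolding assms(3)[symmetric] by (rule sum.reindex_bij_betw[OF bij_betw_nth[OF assms(4) refl refl]])
  also have "\<dots> = (if i = j then int N else 0)"
  proof (cases "i = j")
    case True
    have "bs ! i \<in> B" using ij assms(1) nth_mem by blast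
    then show ?thesis using True sum_weight_square by simp
  next
    case False
    then have "bs ! i \<noteq> bs ! j" using ij assms(2) by (simp add: nth_eq_iff_index_eq)
    moreover have "bs ! i \<in> B" using ij assms(1) nth_mem by blast
    ultimately show ?thesis using False sum_weight_orthogonal by simp
  qed
  finally show "(?X * ?X\<^sup>T) $$ (i, j) = (int N \<cdot>\<^sub>m 1\<^sub>m (length bs)) $$ (i, j)"
    using ij by simp
qed (auto simp: boson_fermion_mat_def)

end

section \<open>Equivalence of square matrices over a commutative ring\<close>

text \<open>
  The two-sided inverses are part of the definition, since inverses with known dimensions are what
  every computation with this relation needs.
\<close>

definition unimodular_equivalent :: "nat \<Rightarrow> 'a :: comm_ring_1 mat \<Rightarrow> 'a mat \<Rightarrow> bool" where
  "unimodular_equivalent n A B \<longleftrightarrow>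
     A \<in> carrier_mat n n \<and>
     (\<exists>P P' Q Q'. {P, P', Q, Q'} \<subseteq> carrier_mat n n \<and>
        P * P' = 1\<^sub>m n \<and> P' * P = 1\<^sub>m n \<and> Q * Q' = 1\<^sub>m n \<and> Q' * Q = 1\<^sub>m n \<and>
        B = P * A * Q)"

lemma unimodular_equivalentI:
  assumes "A \<in> carrier_mat n n" "P \<in> carrier_mat n n" "P' \<in> carrier_mat n n"
    "Q \<in> carrier_mat n n" "Q' \<in> carrier_mat n n"
    "P * P' = 1\<^sub>m n" "P' * P = 1\<^sub>m n" "Q * Q' = 1\<^sub>m n" "Q' * Q = 1\<^sub>m n" "B = P * A * Q"
  shows "unimodular_equivalent n A B"
  unfolding unimodular_equivalent_def using assms by blast

lemma unimodular_equivalentE: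
  assumes "unimodular_equivalent n A B"
  obtains P P' Q Q' where "A \<in> carrier_mat n n" "P \<in> carrier_mat n n" "P' \<in> carrier_mat n n"
    "Q \<in> carrier_mat n n" "Q' \<in> carrier_mat n n"
    "P * P' = 1\<^sub>m n" "P' * P = 1\<^sub>m n" "Q * Q' = 1\<^sub>m n" "Q' * Q = 1\<^sub>m n" "B = P * A * Q"
  using assms unfolding unimodular_equivalent_def by auto

lemma mult_inverse_mat:
  fixes A :: "'a :: comm_ring_1 mat"
  assumes "A \<in> carrier_mat n n" "A' \<in> carrier_mat n n" "B \<in> carrier_mat n n" "B' \<in> carrier_mat n n"
    and "A * A' = 1\<^sub>m n" "B * B' = 1\<^sub>m n"
  shows "(A * B) * (B' * A') = 1\<^sub>m n"
proof -
  have "(A * B) * (B' * A') = A * (B * B') * A'"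
    using assms(1-4) by (simp add: assoc_mult_mat[of _ n n _ n _ n])
  then show ?thesis using assms by simp
qed

lemma unimodular_equivalent_trans:
  assumes "unimodular_equivalent n A B" "unimodular_equivalent n B C"
  shows "unimodular_equivalent n A C"
proof -
  obtain P P' Q Q' where A: "A \<in> carrier_mat n n"
    and c1: "P \<in> carrier_mat n n" "P' \<in> carrier_mat n n" "Q \<in> carrier_mat n n" "Q' \<in> carrier_mat n n"
    and e1: "P * P' = 1\<^sub>m n" "P' * P = 1\<^sub>m n" "Q * Q' = 1\<^sub>m n" "Q' * Q = 1\<^sub>m n"
    and B: "B = P * A * Q"
    using assms(1) by (rule unimodular_equivalentE)
  obtain R R' S S' where
    c2: "R \<in> carrier_mat n n" "R' \<in> carrier_mat n n" "S \<in> carrier_mat n n" "S' \<in> carrier_mat n n"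
    and e2: "R * R' = 1\<^sub>m n" "R' * R = 1\<^sub>m n" "S * S' = 1\<^sub>m n" "S' * S = 1\<^sub>m n"
    and C: "C = R * B * S"
    using assms(2) by (rule unimodular_equivalentE)
  show ?thesis
  proof (rule unimodular_equivalentI[OF A])
    show "(R * P) * (P' * R') = 1\<^sub>m n" "(P' * R') * (R * P) = 1\<^sub>m n"
      "(Q * S) * (S' * Q') = 1\<^sub>m n" "(S' * Q') * (Q * S) = 1\<^sub>m n"
      using c1 c2 e1 e2 by (auto intro!: mult_inverse_mat)
    show "C = (R * P) * A * (Q * S)"
      unfolding C B using A c1 c2 by (simp add: assoc_mult_mat[of _ n n _ n _ n])
  qed (use c1 c2 in auto)
qed

lemma invertible_mat_obtain_inverse:
  assumes "invertible_mat P" "P \<in> carrier_mat n n"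
  obtains P' where "P' \<in> carrier_mat n n" "P * P' = 1\<^sub>m n" "P' * P = 1\<^sub>m n"
proof -
  obtain P' where P': "P * P' = 1\<^sub>m (dim_row P)" "P' * P = 1\<^sub>m (dim_row P')"
    using assms(1) unfolding invertible_mat_def inverts_mat_def by blast
  have "dim_col P' = n" "dim_row P' = n"
    using arg_cong[OF P'(1), of dim_col] arg_cong[OF P'(2), of dim_col] assms(2) by auto
  then show ?thesis using that P' assms(2) by auto
qed

lemma invariant_factors_unimodular_equivalent:
  "invariant_factors M ds \<longleftrightarrow>
     (\<exists>n S. unimodular_equivalent n M S \<and> smith_normal_form S \<and> ds = diag_mat S)"
proof
  assume "invariant_factors M ds"
  then obtain n P Q where M: "M \<in> carrier_mat n n"
    and P: "P \<in> carrier_mat n n" "invertible_mat P"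
    and Q: "Q \<in> carrier_mat n n" "invertible_mat Q"
    and S: "smith_normal_form (P * M * Q)" "ds = diag_mat (P * M * Q)"
    unfolding invariant_factors_def by blast
  obtain P' where P': "P' \<in> carrier_mat n n" "P * P' = 1\<^sub>m n" "P' * P = 1\<^sub>m n"
    using P(2,1) by (rule invertible_mat_obtain_inverse)
  obtain Q' where Q': "Q' \<in> carrier_mat n n" "Q * Q' = 1\<^sub>m n" "Q' * Q = 1\<^sub>m n"
    using Q(2,1) by (rule invertible_mat_obtain_inverse)
  have "unimodular_equivalent n M (P * M * Q)"
    using M P(1) P'(1) Q(1) Q'(1) P'(2,3) Q'(2,3) by (rule unimodular_equivalentI) simp
  then show "\<exists>n S. unimodular_equivalent n M S \<and> smith_normal_form S \<and> ds = diag_mat S"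
    using S by blast
next
  assume "\<exists>n S. unimodular_equivalent n M S \<and> smith_normal_form S \<and> ds = diag_mat S"
  then obtain n S where eq: "unimodular_equivalent n M S"
    and S: "smith_normal_form S" "ds = diag_mat S" by blast
  obtain P P' Q Q' where *: "M \<in> carrier_mat n n" "P \<in> carrier_mat n n" "P' \<in> carrier_mat n n"
    "Q \<in> carrier_mat n n" "Q' \<in> carrier_mat n n"
    "P * P' = 1\<^sub>m n" "P' * P = 1\<^sub>m n" "Q * Q' = 1\<^sub>m n" "Q' * Q = 1\<^sub>m n" "S = P * M * Q"
    using eq by (rule unimodular_equivalentE)
  have "invertible_mat P" "invertible_mat Q"
    using * unfolding invertible_mat_def inverts_mat_def by auto
  then show "invariant_factors M ds"
    unfolding invariant_factors_def using * S by blast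
qed

section \<open>Block matrices with diagonal blocks\<close>

text \<open>
  Up to a permutation of the basis, such a matrix is the direct sum over \<open>k < n\<close> of the
  \<open>2 \<times> 2\<close> matrices with rows \<open>(a k, b k)\<close> and \<open>(c k, d k)\<close>. Products and inverses can
  therefore be computed one \<open>k\<close> at a time.
\<close>

definition diag_blocks ::
    "nat \<Rightarrow> (nat \<Rightarrow> 'a) \<Rightarrow> (nat \<Rightarrow> 'a) \<Rightarrow> (nat \<Rightarrow> 'a) \<Rightarrow> (nat \<Rightarrow> 'a) \<Rightarrow> 'a :: comm_ring_1 mat" where
  "diag_blocks n a b c d = four_block_mat (mat_diag n a) (mat_diag n b) (mat_diag n c) (mat_diag n d)"

lemma diag_blocks_carrier: "diag_blocks n a b c d \<in> carrier_mat (2 * n) (2 * n)"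
  unfolding diag_blocks_def mult_2 by simp

lemma diag_blocks_cong:
  assumes "\<And>k. k < n \<Longrightarrow> a k = a' k \<and> b k = b' k \<and> c k = c' k \<and> d k = d' k"
  shows "diag_blocks n a b c d = diag_blocks n a' b' c' d'"
proof -
  have "mat_diag n f = mat_diag n g" if "\<And>k. k < n \<Longrightarrow> f k = g k" for f g :: "nat \<Rightarrow> 'a"
    unfolding mat_diag_def using that by (intro eq_matI) auto
  from this[of a a'] this[of b b'] this[of c c'] this[of d d']
  show ?thesis unfolding diag_blocks_def using assms by simp
qed

lemma mat_diag_add: "mat_diag n f + mat_diag n g = mat_diag n (\<lambda>i. f i + (g i :: 'a :: comm_ring_1))"
  unfolding mat_diag_def by (intro eq_matI) auto

lemma diag_blocks_mult:
  "diag_blocks n a b c d * diag_blocks n a' b' c' d' =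
     diag_blocks n (\<lambda>k. a k * a' k + b k * c' k) (\<lambda>k. a k * b' k + b k * d' k)
                   (\<lambda>k. c k * a' k + d k * c' k) (\<lambda>k. c k * b' k + d k * d' k)"
  unfolding diag_blocks_def
  by (subst mult_four_block_mat[of _ n n _ n _ n _ _ n _ n]) (simp_all add: mat_diag_add)

lemma diag_blocks_one: "diag_blocks n (\<lambda>_. 1) (\<lambda>_. 0) (\<lambda>_. 0) (\<lambda>_. 1) = 1\<^sub>m (2 * n)"
proof -
  have "mat_diag n (\<lambda>_. 0 :: 'a) = 0\<^sub>m n n"
    unfolding mat_diag_def by (intro eq_matI) auto
  then show ?thesis unfolding diag_blocks_def mult_2 by simp
qed

lemma diag_blocks_inverse:
  assumes "\<And>k. k < n \<Longrightarrow> a k * d k - b k * c k = 1"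
  shows "diag_blocks n a b c d * diag_blocks n d (\<lambda>k. - b k) (\<lambda>k. - c k) a = 1\<^sub>m (2 * n)"
    and "diag_blocks n d (\<lambda>k. - b k) (\<lambda>k. - c k) a * diag_blocks n a b c d = 1\<^sub>m (2 * n)"
  unfolding diag_blocks_mult diag_blocks_one[symmetric]
  using assms by (auto intro!: diag_blocks_cong simp: algebra_simps)

lemma diag_blocks_unimodular_equivalent:
  fixes a b c d :: "nat \<Rightarrow> 'a :: comm_ring_1"
  assumes "\<And>k. k < n \<Longrightarrow> p1 k * p4 k - p2 k * p3 k = 1"
    and "\<And>k. k < n \<Longrightarrow> q1 k * q4 k - q2 k * q3 k = 1"
  shows "unimodular_equivalent (2 * n) (diag_blocks n a b c d)
    (diag_blocks n p1 p2 p3 p4 * diag_blocks n a b c d * diag_blocks n q1 q2 q3 q4)"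
  using diag_blocks_inverse[of n p1 p4 p2 p3, OF assms(1)] diag_blocks_inverse[of n q1 q4 q2 q3, OF assms(2)]
  by (intro unimodular_equivalentI[OF _ _ _ _ _ _ _ _ _ refl]) (auto intro: diag_blocks_carrier)

text \<open>Conjugation with a permutation matrix, whose inverse is its transpose.\<close>

lemma permute_diagonal:
  fixes f :: "nat \<Rightarrow> 'a :: comm_ring_1"
  assumes "bij_betw p {..<n} {..<n}"
  shows "unimodular_equivalent n (mat_diag n f) (mat_diag n (\<lambda>i. f (p i)))"
proof -
  define R :: "'a mat" where "R = mat n n (\<lambda>(i, j). if j = p i then 1 else 0)"
  have R: "R \<in> carrier_mat n n" unfolding R_def by simp
  have lt: "p i < n" if "i < n" for i using assms that unfolding bij_betw_def by auto
  have inj: "p i = p j \<longleftrightarrow> i = j" if "i < n" "j < n" for i j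
    using assms that unfolding bij_betw_def inj_on_def by auto
  have RR: "R * mat_diag n g * R\<^sup>T = mat_diag n (\<lambda>i. g (p i))" for g
    unfolding mat_diag_mult_right[OF R]
    by (intro eq_matI)
      (auto simp: R_def mat_diag_def scalar_prod_def lt inj if_distrib cong: if_cong)
  have right: "R * R\<^sup>T = 1\<^sub>m n"
    using RR[of "\<lambda>_. 1"] R by simp
  have left: "R\<^sup>T * R = 1\<^sub>m n"
  proof (intro eq_matI)
    fix i j assume ij: "i < dim_row (1\<^sub>m n :: 'a mat)" "j < dim_col (1\<^sub>m n :: 'a mat)"
    have "(R\<^sup>T * R) $$ (i, j) = (\<Sum>k<n. (if i = p k then 1 else 0) * (if j = p k then 1 else 0))"
      using ij by (simp add: R_def scalar_prod_def lessThan_atLeast0)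
    also have "\<dots> = (\<Sum>k<n. (if i = k then 1 else 0) * (if j = k then 1 else 0))"
      by (rule sum.reindex_bij_betw[OF assms])
    also have "\<dots> = (\<Sum>k<n. if k = i then if j = i then 1 else 0 else 0)"
      by (intro sum.cong) auto
    also have "\<dots> = (1\<^sub>m n :: 'a mat) $$ (i, j)"
      using ij by auto
    finally show "(R\<^sup>T * R) $$ (i, j) = 1\<^sub>m n $$ (i, j)" .
  qed (use R in auto)
  show ?thesis
    by (rule unimodular_equivalentI[OF _ R _ _ R right left left right RR[symmetric]]) (use R in auto)
qed

lemma diagonal_mat_eq_mat_diag:
  assumes "S \<in> carrier_mat n n" "diagonal_mat S"
  shows "S = mat_diag n (\<lambda>i. diag_mat S ! i)"
  using assms unfolding diagonal_mat_def mat_diag_def diag_mat_def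
  by (intro eq_matI) auto

lemma diag_blocks_diagonal:
  "diag_blocks n a (\<lambda>_. 0) (\<lambda>_. 0) b = mat_diag (2 * n) (\<lambda>i. if i < n then a i else b (i - n))"
  unfolding diag_blocks_def mat_diag_def by (intro eq_matI) auto

section \<open>Reduction of the Laplacian\<close>

lemma signed_laplacian_four_block:
  assumes "X \<in> carrier_mat n n"
  shows "signed_laplacian_mat N X =
    four_block_mat (int N \<cdot>\<^sub>m 1\<^sub>m n) (- X) (- X\<^sup>T) (int N \<cdot>\<^sub>m 1\<^sub>m n)"
  unfolding signed_laplacian_mat_def signed_adjacency_mat_def
  using assms by (intro eq_matI) auto

text \<open>
  Multiplication by the block diagonal matrices \<open>diag(P, Q\<^sup>-\<^sup>1)\<close> and \<open>diag(P\<^sup>-\<^sup>1, Q)\<close> leaves the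
  diagonal blocks \<open>N I\<close> alone and diagonalizes both \<open>X\<close> and \<open>X\<^sup>T\<close>: the matrix \<open>D'\<close> obtained
  from \<open>X\<^sup>T\<close> is \<open>N D\<^sup>-\<^sup>1\<close>. That \<open>D'\<close> has integer entries shows that the \<open>d k\<close> divide \<open>N\<close>.
\<close>

lemma signed_laplacian_unimodular_equivalent:
  assumes X: "X \<in> carrier_mat n n" and XX: "X * X\<^sup>T = int N \<cdot>\<^sub>m 1\<^sub>m n" and N: "N > 0"
    and eq: "unimodular_equivalent n X (mat_diag n d)"
  shows "\<And>k. k < n \<Longrightarrow> d k dvd int N"
    and "unimodular_equivalent (2 * n) (signed_laplacian_mat N X)
      (diag_blocks n (\<lambda>_. int N) (\<lambda>k. - d k) (\<lambda>k. - (int N div d k)) (\<lambda>_. int N))"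
proof -
  obtain P P' Q Q' where
    c: "P \<in> carrier_mat n n" "P' \<in> carrier_mat n n" "Q \<in> carrier_mat n n" "Q' \<in> carrier_mat n n"
    and e: "P * P' = 1\<^sub>m n" "P' * P = 1\<^sub>m n" "Q * Q' = 1\<^sub>m n" "Q' * Q = 1\<^sub>m n"
    and D: "mat_diag n d = P * X * Q"
    using eq by (rule unimodular_equivalentE)
  note assoc = assoc_mult_mat[of _ n n _ n _ n]
  have XT: "X\<^sup>T \<in> carrier_mat n n" using X by simp
  define D' where "D' = Q' * X\<^sup>T * P'"
  have D': "D' \<in> carrier_mat n n" unfolding D'_def using c XT by (auto intro!: mult_carrier_mat)
  have "mat_diag n d * D' = P * X * (Q * Q') * X\<^sup>T * P'"
    unfolding D D'_def using c X XT by (simp add: assoc)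
  also have "\<dots> = P * (X * X\<^sup>T) * P'"
    using c X XT by (simp add: e assoc)
  also have "\<dots> = int N \<cdot>\<^sub>m (P * P')"
    unfolding XX using c by (simp add: mult_smult_distrib[of _ n n _ n] mult_smult_assoc_mat[of _ n n _ n])
  finally have DD': "mat_diag n d * D' = int N \<cdot>\<^sub>m 1\<^sub>m n" by (simp add: e)
  have entry: "d i * D' $$ (i, j) = (if i = j then int N else 0)" if "i < n" "j < n" for i j
    using arg_cong[OF DD', of "\<lambda>M. M $$ (i, j)"] that unfolding mat_diag_mult_left[OF D'] by simp
  show "d k dvd int N" if "k < n" for k
    using entry[OF that that] by (metis dvd_triv_left)
  have D'_diag: "D' = mat_diag n (\<lambda>k. int N div d k)"
  proof (rule eq_matI)
    fix i j assume "i < dim_row (mat_diag n (\<lambda>k. int N div d k))"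
      "j < dim_col (mat_diag n (\<lambda>k. int N div d k))"
    then have ij: "i < n" "j < n" by (auto simp: mat_diag_def)
    have "d i \<noteq> 0" using entry[OF ij(1) ij(1)] N by auto
    then have "D' $$ (i, j) = (if i = j then int N div d i else 0)"
      using entry[OF ij] by (metis mult_eq_0_iff nonzero_mult_div_cancel_left)
    then show "D' $$ (i, j) = mat_diag n (\<lambda>k. int N div d k) $$ (i, j)"
      using ij by (simp add: mat_diag_def)
  qed (use D' in \<open>auto simp: mat_diag_def\<close>)
  define Z :: "int mat" where "Z = 0\<^sub>m n n"
  have Z: "Z \<in> carrier_mat n n" unfolding Z_def by simp
  define I where "I = int N \<cdot>\<^sub>m (1\<^sub>m n :: int mat)"
  have I: "I \<in> carrier_mat n n" unfolding I_def by simp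
  note block_mult = mult_four_block_mat[of _ n n _ n _ n _ _ n _ n]
  have one: "four_block_mat A Z Z B * four_block_mat A' Z Z B' = 1\<^sub>m (2 * n)"
    if "{A, A', B, B'} \<subseteq> carrier_mat n n" "A * A' = 1\<^sub>m n" "B * B' = 1\<^sub>m n" for A A' B B'
    using that by (subst block_mult) (auto simp: Z_def mult_2)
  have I_eq: "I = mat_diag n (\<lambda>_. int N)"
    unfolding I_def mat_diag_def by (intro eq_matI) auto
  have neg: "- mat_diag n g = mat_diag n (\<lambda>k. - g k)" for g :: "nat \<Rightarrow> int"
    unfolding mat_diag_def by (intro eq_matI) auto
  have I_comm: "P * I * P' = I" "Q' * I * Q = I"
    unfolding I_def using c e
    by (simp_all add: mult_smult_distrib[of _ n n _ n] mult_smult_assoc_mat[of _ n n _ n])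
  have neg0: "- (0\<^sub>m n n) = (0\<^sub>m n n :: int mat)"
    by (intro eq_matI) auto
  have "four_block_mat P Z Z Q' * signed_laplacian_mat N X * four_block_mat P' Z Z Q =
      four_block_mat (P * I) (P * - X) (Q' * - X\<^sup>T) (Q' * I) * four_block_mat P' Z Z Q"
    unfolding signed_laplacian_four_block[OF X] I_def[symmetric]
    using c X XT I Z by (subst block_mult) (auto simp: Z_def neg0)
  also have "\<dots> = four_block_mat (P * I * P') (P * - X * Q) (Q' * - X\<^sup>T * P') (Q' * I * Q)"
    using c X XT I Z by (subst block_mult) (auto simp: Z_def neg0)
  also have "\<dots> = four_block_mat I (- (P * X * Q)) (- D') I"
    unfolding I_comm D'_def using c X XT by simp
  also have "\<dots> = diag_blocks n (\<lambda>_. int N) (\<lambda>k. - d k) (\<lambda>k. - (int N div d k)) (\<lambda>_. int N)"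
    unfolding D[symmetric] D'_diag I_eq neg diag_blocks_def ..
  finally have result: "four_block_mat P Z Z Q' * signed_laplacian_mat N X * four_block_mat P' Z Z Q =
      diag_blocks n (\<lambda>_. int N) (\<lambda>k. - d k) (\<lambda>k. - (int N div d k)) (\<lambda>_. int N)" .
  show "unimodular_equivalent (2 * n) (signed_laplacian_mat N X)
      (diag_blocks n (\<lambda>_. int N) (\<lambda>k. - d k) (\<lambda>k. - (int N div d k)) (\<lambda>_. int N))"
  proof (rule unimodular_equivalentI[OF _ _ _ _ _ _ _ _ _ result[symmetric]])
    show "signed_laplacian_mat N X \<in> carrier_mat (2 * n) (2 * n)"
      unfolding signed_laplacian_four_block[OF X] mult_2 by simp
    show "four_block_mat P Z Z Q' \<in> carrier_mat (2 * n) (2 * n)"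
      "four_block_mat P' Z Z Q \<in> carrier_mat (2 * n) (2 * n)"
      "four_block_mat P' Z Z Q \<in> carrier_mat (2 * n) (2 * n)"
      "four_block_mat P Z Z Q' \<in> carrier_mat (2 * n) (2 * n)"
      unfolding mult_2 using c by auto
  qed (use c e in \<open>auto intro!: one\<close>)
qed

text \<open>
  With \<open>x y = N\<close>, adding \<open>y\<close> times the row \<open>(N, - x)\<close> to the row \<open>(- y, N)\<close> turns the
  latter into \<open>((N - 1) y, 0)\<close>. A multiple of the column \<open>(- x, 0)\<close> then clears \<open>N\<close>, so the
  entries \<open>x\<close> and \<open>(N - 1) y\<close> remain up to sign and order. For \<open>k\<close> in
  the lower half \<open>x = d k\<close>, in the upper half \<open>y = d k\<close>; with this choice the \<open>k\<close>-th summand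
  becomes the diagonal matrix with entries \<open>f k\<close> and \<open>f (2 * m - 1 - k)\<close>.
\<close>

lemma diag_blocks_laplacian_reduction:
  fixes d :: "nat \<Rightarrow> int" and N :: int
  assumes d: "\<And>k. k < 2 * m \<Longrightarrow> d k * d (2 * m - 1 - k) = N"
  defines "f \<equiv> \<lambda>j. if j < m then d j else (N - 1) * d j"
  shows "unimodular_equivalent (2 * (2 * m))
    (diag_blocks (2 * m) (\<lambda>_. N) (\<lambda>k. - d k) (\<lambda>k. - d (2 * m - 1 - k)) (\<lambda>_. N))
    (diag_blocks (2 * m) f (\<lambda>_. 0) (\<lambda>_. 0) (\<lambda>k. f (2 * m - 1 - k)))"
proof -
  let ?r = "\<lambda>k. 2 * m - 1 - k"
  let ?L = "diag_blocks (2 * m) (\<lambda>_. N) (\<lambda>k. - d k) (\<lambda>k. - d (?r k)) (\<lambda>_. N)"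
  let ?U = "diag_blocks (2 * m) (\<lambda>_. 1) (\<lambda>k. if k < m then 0 else d k)
    (\<lambda>k. if k < m then d (?r k) else 0) (\<lambda>_. 1)"
  let ?W = "diag_blocks (2 * m) (\<lambda>k. if k < m then 0 else d k) (\<lambda>k. if k < m then 1 else - 1)
    (\<lambda>k. if k < m then - 1 else 1) (\<lambda>k. if k < m then d (?r k) else 0)"
  \<comment> \<open>\<open>?U\<close> adds \<open>y\<close> times one row to the other. \<open>?W\<close> does the same to the columns and also
    exchanges them, with one sign changed so that its determinant is \<open>1\<close> and \<open>f\<close> comes out without
    signs.\<close>
  have "unimodular_equivalent (2 * (2 * m)) ?L (?U * ?L * ?W)"
    by (rule diag_blocks_unimodular_equivalent) auto
  also have "?U * ?L * ?W = diag_blocks (2 * m) f (\<lambda>_. 0) (\<lambda>_. 0) (\<lambda>k. f (?r k))"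
    unfolding diag_blocks_mult
  proof (rule diag_blocks_cong)
    fix k assume k: "k < 2 * m"
    have N: "N = d k * d (?r k)" using d[OF k] by simp
    have r: "?r k < m \<longleftrightarrow> \<not> k < m" using k by auto
    show "(1 * N + (if k < m then 0 else d k) * - d (?r k)) * (if k < m then 0 else d k) +
        (1 * - d k + (if k < m then 0 else d k) * N) * (if k < m then - 1 else 1) = f k \<and>
      (1 * N + (if k < m then 0 else d k) * - d (?r k)) * (if k < m then 1 else - 1) +
        (1 * - d k + (if k < m then 0 else d k) * N) * (if k < m then d (?r k) else 0) = 0 \<and>
      ((if k < m then d (?r k) else 0) * N + 1 * - d (?r k)) * (if k < m then 0 else d k) +
        ((if k < m then d (?r k) else 0) * - d k + 1 * N) * (if k < m then - 1 else 1) = 0 \<and>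
      ((if k < m then d (?r k) else 0) * N + 1 * - d (?r k)) * (if k < m then 1 else - 1) +
        ((if k < m then d (?r k) else 0) * - d k + 1 * N) * (if k < m then d (?r k) else 0)
          = f (?r k)"
      unfolding f_def r by (auto simp: N algebra_simps)
  qed
  finally show ?thesis .
qed

text \<open>
  The diagonal is \<open>f 0, \<dots>, f (n - 1), f (n - 1), \<dots>, f 0\<close>; taking entries alternately from its
  front and its back lists every value twice in a row.
\<close>

lemma interleave_diagonal:
  fixes f :: "nat \<Rightarrow> 'a :: comm_ring_1"
  shows "unimodular_equivalent (2 * n) (diag_blocks n f (\<lambda>_. 0) (\<lambda>_. 0) (\<lambda>k. f (n - 1 - k)))
    (mat_diag (2 * n) (\<lambda>t. f (t div 2)))"
proof -
  define g where "g i = (if i < n then f i else f (n - 1 - (i - n)))" for i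
  define p where "p t = (if even t then t div 2 else 2 * n - 1 - t div 2)" for t :: nat
  have "inj_on p {..<2 * n}"
  proof (rule inj_onI)
    fix s t assume "s \<in> {..<2 * n}" "t \<in> {..<2 * n}" "p s = p t"
    then have "s < 2 * n" "t < 2 * n" "p s = p t" by auto
    then show "s = t" unfolding p_def by (auto split: if_splits elim!: evenE oddE)
  qed
  moreover have "p ` {..<2 * n} \<subseteq> {..<2 * n}" unfolding p_def by auto
  ultimately have p: "bij_betw p {..<2 * n} {..<2 * n}"
    by (simp add: bij_betw_def endo_inj_surj)
  have "unimodular_equivalent (2 * n) (mat_diag (2 * n) g) (mat_diag (2 * n) (\<lambda>t. g (p t)))"
    by (rule permute_diagonal[OF p])
  also have "mat_diag (2 * n) (\<lambda>t. g (p t)) = mat_diag (2 * n) (\<lambda>t. f (t div 2))"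
  proof -
    have "g (p t) = f (t div 2)" if "t < 2 * n" for t
    proof -
      have "t div 2 < n" using that by auto
      then show ?thesis unfolding g_def p_def by auto
    qed
    then show ?thesis unfolding mat_diag_def by (intro eq_matI) auto
  qed
  finally show ?thesis unfolding diag_blocks_diagonal g_def .
qed

lemma map_upt_double: "map (\<lambda>t. f (t div 2)) [0..<2 * n] = concat (map (\<lambda>j. [f j, f j]) [0..<n])"
  by (induction n) auto

lemma smith_normal_form_mat_diag:
  assumes "\<And>i. i < n \<Longrightarrow> f i \<ge> 0" "\<And>i. Suc i < n \<Longrightarrow> f i dvd f (Suc i)"
  shows "smith_normal_form (mat_diag n f)"
  using assms unfolding smith_normal_form_def diagonal_mat_def mat_diag_def by auto

section \<open>Invariant factors of the Laplacian\<close>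

theorem theorem15:
  fixes V :: "'a set" and E :: "'a set set" and \<mu> :: "'a set \<Rightarrow> int" and N :: nat
    and B F :: "'a set" and color :: "'a set \<Rightarrow> nat" and h :: "'a \<Rightarrow> int"
    and bs fs :: "'a list" and X L :: "int mat" and ds xs :: "int list"
  assumes "adinkra V E \<mu> N B F color h"
    and "4 dvd card V"
    and "distinct bs" "set bs = B"
    and "distinct fs" "set fs = F"
    and "X = boson_fermion_mat E \<mu> bs fs"
    and "L = signed_laplacian_mat N X"
    and "length xs = card V div 4"
    and "invariant_factors X ds"
    and "map rat_of_int ds =
           map rat_of_int xs @ rev (map (\<lambda>x. rat_of_nat N / rat_of_int x) xs)"
  shows "\<exists>es. invariant_factors L es \<and>
           map rat_of_int es =
             concat (map (\<lambda>x. [x, x])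
               (map rat_of_int xs @
                rev (map (\<lambda>x. rat_of_nat N * (rat_of_nat N - 1) / rat_of_int x) xs)))"
proof -
  interpret adinkra V E \<mu> N B F color h by (rule assms(1))
  have N: "N > 0" using N_pos by simp
  obtain n S where eq: "unimodular_equivalent n X S" and S: "smith_normal_form S" "ds = diag_mat S"
    using assms(10) unfolding invariant_factors_unimodular_equivalent by blast
  from eq have X: "X \<in> carrier_mat n n" and Sc: "S \<in> carrier_mat n n"
    by (auto elim!: unimodular_equivalentE)
  have bs: "length bs = n" using X unfolding assms(7) boson_fermion_mat_def by auto
  have XX: "X * X\<^sup>T = int N \<cdot>\<^sub>m 1\<^sub>m n"
    using boson_fermion_mat_mult_transpose[OF assms(4,3,6,5)] unfolding assms(7) bs .
  define m where "m = length xs"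
  have "length ds = n" using S(2) Sc by (simp add: diag_mat_def)
  moreover have "length ds = 2 * m"
    using arg_cong[OF assms(11), of length] unfolding m_def by simp
  ultimately have n: "n = 2 * m" by simp
  define d where "d i = ds ! i" for i
  have d_S: "d i = S $$ (i, i)" if "i < n" for i
    using that Sc unfolding d_def S(2) diag_mat_def by simp
  have S_diag: "S = mat_diag n d"
    using diagonal_mat_eq_mat_diag[OF Sc] S unfolding smith_normal_form_def d_def by simp
  have d_nonneg: "d i \<ge> 0" if "i < n" for i
    using S(1) Sc that unfolding smith_normal_form_def by (simp add: d_S)
  have d_dvd: "d i dvd d (Suc i)" if "Suc i < n" for i
    using S(1) Sc that unfolding smith_normal_form_def by (simp add: d_S)
  note lap = signed_laplacian_unimodular_equivalent[OF X XX N eq[unfolded S_diag]]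
  have d_nonzero: "d i \<noteq> 0" if "i < n" for i
    using lap(1)[OF that] N by auto
  have nth_ds: "rat_of_int (d i) =
      (map rat_of_int xs @ rev (map (\<lambda>x. rat_of_nat N / rat_of_int x) xs)) ! i" if "i < n" for i
    using that arg_cong[OF assms(11), of "\<lambda>l. l ! i"] \<open>length ds = n\<close> unfolding d_def by simp
  have d_low: "d k = xs ! k" if "k < m" for k
    using nth_ds[of k] that n unfolding m_def by (simp add: nth_append)
  have d_high: "rat_of_int (d (n - 1 - k)) = rat_of_nat N / rat_of_int (xs ! k)" if "k < m" for k
  proof -
    have "n - 1 - k < n" "\<not> n - 1 - k < m" "n - 1 - k - m = m - Suc k" "m - Suc (m - Suc k) = k"
      using that n by auto
    then show ?thesis
      using nth_ds[of "n - 1 - k"] that by (simp add: nth_append rev_nth m_def[symmetric])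
  qed
  \<comment> \<open>If some \<open>x\<close> were \<open>0\<close>, the rational quotient would be the default value \<open>0\<close> and the pairing
    would fail; \<open>d_nonzero\<close> excludes this.\<close>
  have pair_low: "d k * d (n - 1 - k) = int N" if "k < m" for k
  proof -
    have "rat_of_int (d k * d (n - 1 - k)) = rat_of_int (int N)"
      using d_high[OF that] d_low[OF that] d_nonzero[of k] that n by simp
    then show ?thesis by (simp only: of_int_eq_iff)
  qed
  have pair: "d k * d (n - 1 - k) = int N" if "k < n" for k
    using pair_low[of k] pair_low[of "n - 1 - k"] that n by (cases "k < m") (auto simp: mult.commute)
  define f where "f j = (if j < m then d j else (int N - 1) * d j)" for j
  define T where "T = mat_diag (2 * n) (\<lambda>t. f (t div 2))"
  have "diag_blocks n (\<lambda>_. int N) (\<lambda>k. - d k) (\<lambda>k. - (int N div d k)) (\<lambda>_. int N) =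
      diag_blocks n (\<lambda>_. int N) (\<lambda>k. - d k) (\<lambda>k. - d (n - 1 - k)) (\<lambda>_. int N)"
    using pair d_nonzero by (intro diag_blocks_cong) (metis nonzero_mult_div_cancel_left)
  then have "unimodular_equivalent (2 * n) L
      (diag_blocks n (\<lambda>_. int N) (\<lambda>k. - d k) (\<lambda>k. - d (n - 1 - k)) (\<lambda>_. int N))"
    using lap(2) assms(8) by simp
  moreover have "unimodular_equivalent (2 * n)
      (diag_blocks n (\<lambda>_. int N) (\<lambda>k. - d k) (\<lambda>k. - d (n - 1 - k)) (\<lambda>_. int N))
      (diag_blocks n f (\<lambda>_. 0) (\<lambda>_. 0) (\<lambda>k. f (n - 1 - k)))"
    using diag_blocks_laplacian_reduction[of m d "int N"] pair unfolding n f_def by simp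
  ultimately have "unimodular_equivalent (2 * n) L T"
    unfolding T_def using interleave_diagonal unimodular_equivalent_trans by blast
  moreover have "smith_normal_form T"
    unfolding T_def
  proof (rule smith_normal_form_mat_diag)
    show "f (i div 2) \<ge> 0" if "i < 2 * n" for i
      using d_nonneg[of "i div 2"] that N unfolding f_def by auto
    have step: "f j dvd f (Suc j)" if "Suc j < n" for j
      using d_dvd[OF that] unfolding f_def by (auto intro: dvd_mult mult_dvd_mono)
    show "f (i div 2) dvd f (Suc i div 2)" if "Suc i < 2 * n" for i
    proof (cases "even i")
      case False
      then have "Suc i div 2 = Suc (i div 2)" by simp
      then show ?thesis using step[of "i div 2"] that by auto
    qed simp
  qed
  ultimately have "invariant_factors L (diag_mat T)"
    unfolding invariant_factors_unimodular_equivalent by blast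
  moreover have "map rat_of_int (diag_mat T) = concat (map (\<lambda>x. [x, x])
      (map rat_of_int xs @
       rev (map (\<lambda>x. rat_of_nat N * (rat_of_nat N - 1) / rat_of_int x) xs)))"
  proof -
    have "diag_mat T = map (\<lambda>t. f (t div 2)) [0..<2 * n]"
      unfolding T_def diag_mat_def mat_diag_def by simp
    then have "map rat_of_int (diag_mat T) =
        concat (map (\<lambda>x. [x, x]) (map (\<lambda>j. rat_of_int (f j)) [0..<n]))"
      by (simp add: map_upt_double map_concat comp_def)
    also have "map (\<lambda>j. rat_of_int (f j)) [0..<n] = map rat_of_int xs @
        rev (map (\<lambda>x. rat_of_nat N * (rat_of_nat N - 1) / rat_of_int x) xs)"
    proof (rule nth_equalityI)
      fix i assume "i < length (map (\<lambda>j. rat_of_int (f j)) [0..<n])"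
      then have i: "i < n" by simp
      show "map (\<lambda>j. rat_of_int (f j)) [0..<n] ! i = (map rat_of_int xs @
        rev (map (\<lambda>x. rat_of_nat N * (rat_of_nat N - 1) / rat_of_int x) xs)) ! i"
      proof (cases "i < m")
        case True
        then show ?thesis using i d_low by (simp add: f_def nth_append m_def)
      next
        case False
        define k where "k = n - 1 - i"
        have k: "k < m" "i = n - 1 - k" using False i n unfolding k_def by auto
        have "i - m = m - Suc k" "m - Suc (m - Suc k) = k" using k n by auto
        moreover have "rat_of_int (d i) = rat_of_nat N / rat_of_int (xs ! k)"
          using d_high[OF k(1)] unfolding k(2) .
        ultimately show ?thesis
          using i False k(1) by (simp add: f_def nth_append rev_nth m_def[symmetric])
      qed
    qed (simp add: n m_def)
    finally show ?thesis .
  qed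
  ultimately show ?thesis by blast
qed

end
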